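(* Let $d>0$, let $A$ be a full rank $r\times n$ integer matrix ($r\le n$) whose greatest divisor $\delta(A)$ divides $d$, and put $k=d/\delta(A)$. Let $U$ be an $n\times n$ unimodular integer matrix such that $AU$ is in RHNF form, i.e. $AU=[N\ O]$ with $N$ an $r\times r$ matrix in RHNF and $O$ a zero matrix, and let $U'$ be an $r\times r$ unimodular integer matrix such that $U'AU=[N'\ O]$ with $N'$ in LHNF. Let $B$ be any $(n-r)\times n$ integer matrix such that the $n\times n$ matrix $\begin{bmatrix} U'AU\\ B\end{bmatrix}$ is in LHNF and the product of its diagonal entries in positions $r+1,\dots,n$ equals $k$. Then $X=BU^{-1}$ is an integer $(n-r)\times n$ matrix satisfying $\det\begin{bmatrix} A\\ X\end{bmatrix}=\pm d$.
   Context: An integer square matrix $U$ is unimodular if $\det U=\pm 1$. For a full rank integer $r\times n$ matrix $M$ with $r\le n$, the greatest divisor $\delta(M)$ is the greatest common divisor of all the $r\times r$ minors of $M$. A square nonsingular integer matrix $N=(a_{ij})$ is in LHNF if it is lower triangular, has nonnegative entries, and $a_{ii}>0$, $0\le a_{ji}<a_{ii}$ for all $j>i$ (column condition); it is in RHNF if it is lower triangular, has nonnegative entries, and $a_{ii}>0$, $0\le a_{ij}<a_{ii}$ for all $j<i$ (row condition). For $\begin{bmatrix} A\\ X\end{bmatrix}$ denotes the $n\times n$ matrix obtained by stacking the rows of $A$ above the rows of $X$. *)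

theory Defs
  imports
    "Jordan_Normal_Form.DL_Rank_Submatrix"
    "Jordan_Normal_Form.Gauss_Jordan_Elimination"
begin

definition unimodular :: "int mat \<Rightarrow> bool" where
  "unimodular U \<longleftrightarrow> square_mat U \<and> (det U = 1 \<or> det U = - 1)"

(* The rank of an integer matrix is its rank over the rationals; the library's rank takes
   the number of rows as its first argument. *)
definition full_rank :: "int mat \<Rightarrow> bool" where
  "full_rank M \<longleftrightarrow>
     vec_space.rank (dim_row M) (map_mat rat_of_int M) = min (dim_row M) (dim_col M)"

(* The maximal minors are obtained by keeping all rows and choosing as many columns as
   there are rows, so this is meant for matrices with dim_row M \<le> dim_col M. *)
definition greatest_divisor :: "int mat \<Rightarrow> int" where
  "greatest_divisor M =
     Gcd {det (submatrix M UNIV J) | J. J \<subseteq> {..<dim_col M} \<and> card J = dim_row M}"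

definition lower_triangular :: "int mat \<Rightarrow> bool" where
  "lower_triangular N \<longleftrightarrow> (\<forall>i < dim_row N. \<forall>j < dim_col N. i < j \<longrightarrow> N $$ (i, j) = 0)"

definition nonneg_mat :: "int mat \<Rightarrow> bool" where
  "nonneg_mat N \<longleftrightarrow> (\<forall>i < dim_row N. \<forall>j < dim_col N. 0 \<le> N $$ (i, j))"

(* Entries below the diagonal are reduced modulo the diagonal entry of their column. *)
definition LHNF :: "int mat \<Rightarrow> bool" where
  "LHNF N \<longleftrightarrow> square_mat N \<and> det N \<noteq> 0 \<and> lower_triangular N \<and> nonneg_mat N \<and>
     (\<forall>i < dim_row N. 0 < N $$ (i, i) \<and>
        (\<forall>j < dim_row N. i < j \<longrightarrow> 0 \<le> N $$ (j, i) \<and> N $$ (j, i) < N $$ (i, i)))"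

(* Entries left of the diagonal are reduced modulo the diagonal entry of their row. *)
definition RHNF :: "int mat \<Rightarrow> bool" where
  "RHNF N \<longleftrightarrow> square_mat N \<and> det N \<noteq> 0 \<and> lower_triangular N \<and> nonneg_mat N \<and>
     (\<forall>i < dim_row N. 0 < N $$ (i, i) \<and>
        (\<forall>j < i. 0 \<le> N $$ (i, j) \<and> N $$ (i, j) < N $$ (i, i)))"

definition append_cols :: "'a :: zero mat \<Rightarrow> 'a mat \<Rightarrow> 'a mat" (infixr "@\<^sub>c" 65) where
  "A @\<^sub>c B = four_block_mat A B (0\<^sub>m 0 (dim_col A)) (0\<^sub>m 0 (dim_col B))"

end

theory Submission
  imports Defs
begin

text \<open>Write \<open>A = N W\<close> where \<open>W\<close> consists of the first \<open>r\<close> rows of \<open>U\<^sup>-\<^sup>1\<close>. Every maximal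
  minor of \<open>A\<close> is then a multiple of \<open>det N\<close>; conversely, \<open>N\<close> is \<open>A\<close> times the first \<open>r\<close> columns
  of \<open>U\<close>, so expanding \<open>det N\<close> multilinearly exhibits it as an integer combination of maximal minors.
  Hence \<open>\<delta>(A) = \<bar>det N\<bar> = \<bar>det N'\<bar>\<close>, and since \<open>[A; X]\<close> differs from the triangular matrix
  \<open>[U'AU; B]\<close> only by unimodular factors, its determinant is \<open>\<plusminus> det N' \<cdot> k = \<plusminus> d\<close>.\<close>

lemma submatrix_UNIV_cols:
  assumes "A \<in> carrier_mat r n" "J \<subseteq> {..<n}"
  shows "submatrix A UNIV J = mat r (card J) (\<lambda>(i, j). A $$ (i, pick J j))"
proof -
  have "{j. j < n \<and> j \<in> J} = J" using assms by auto
  then show ?thesis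
    using assms unfolding submatrix_def by (auto simp: pick_UNIV)
qed

lemma greatest_divisor_dvd_det_cols:
  fixes A :: "int mat"
  assumes A: "A \<in> carrier_mat r n" and f: "f \<in> {0..<r} \<rightarrow> {..<n}"
  shows "greatest_divisor A dvd det (mat\<^sub>r r r (\<lambda>i. col A (f i)))"
proof (cases "inj_on f {0..<r}")
  case False
  then obtain i j where ij: "i < r" "j < r" "i \<noteq> j" "f i = f j"
    unfolding inj_on_def by auto
  have "det (mat\<^sub>r r r (\<lambda>i. col A (f i))) = 0"
    by (rule det_identical_rows[of _ r i j]) (use ij A in auto)
  then show ?thesis by simp
next
  case True
  define J where "J = f ` {0..<r}"
  \<comment> \<open>\<open>p i\<close> is the position of \<open>f i\<close> in the increasing
    enumeration \<open>pick J\<close>; it is the identity from \<open>r\<close> on because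
    \<open>permutes\<close> demands this.\<close>
  define p where "p i = (if i < r then card {a \<in> J. a < f i} else i)" for i
  have J: "J \<subseteq> {..<n}" "card J = r" and fJ: "finite J"
    using f card_image[OF True] by (auto simp: J_def)
  have pick_p: "pick J (p i) = f i" if "i < r" for i
    using that by (simp add: p_def J_def pick_card_in_set)
  have p_less: "p i < r" if "i < r" for i
  proof -
    have "{a \<in> J. a < f i} \<subset> J" using that by (auto simp: J_def)
    from psubset_card_mono[OF fJ this] show ?thesis using that J by (simp add: p_def)
  qed
  have "inj_on p {0..<r}"
  proof (rule inj_onI)
    fix i j assume "i \<in> {0..<r}" "j \<in> {0..<r}" "p i = p j"
    then show "i = j" using True pick_p[of i] pick_p[of j] by (auto simp: inj_on_def)
  qed
  moreover from this have "p ` {0..<r} = {0..<r}"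
    by (intro endo_inj_surj) (use p_less in auto)
  ultimately have p: "p permutes {0..<r}"
    by (intro bij_imp_permutes) (auto simp: bij_betw_def p_def)
  let ?S = "submatrix A UNIV J"
  have S: "?S = mat r r (\<lambda>(i, j). A $$ (i, pick J j))"
    using submatrix_UNIV_cols[OF A J(1)] J by simp
  have f_less: "f i < n" if "i < r" for i using f that by auto
  have "mat\<^sub>r r r (\<lambda>i. col A (f i)) = mat r r (\<lambda>(i, j). transpose_mat ?S $$ (p i, j))"
    by (rule eq_matI) (use A pick_p p_less f_less in \<open>auto simp: S\<close>)
  also have "det \<dots> = signof p * det (transpose_mat ?S)"
    by (rule det_permute_rows[OF _ p]) (simp add: S)
  also have "det (transpose_mat ?S) = det ?S"
    by (rule det_transpose[of _ r]) (simp add: S)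
  finally have "det (mat\<^sub>r r r (\<lambda>i. col A (f i))) = signof p * det ?S" .
  moreover have "greatest_divisor A dvd det ?S"
    unfolding greatest_divisor_def using A J by (intro Gcd_dvd) auto
  ultimately show ?thesis by simp
qed

text \<open>The columns of \<open>A * V\<close> are integer combinations of columns of
  \<open>A\<close>, so multilinearity expands the determinant into multiples of determinants of
  column choices. This is the Cauchy-Binet expansion before equal column sets are collected.\<close>

lemma greatest_divisor_dvd_det_mult:
  fixes A :: "int mat"
  assumes A: "A \<in> carrier_mat r n" and V: "V \<in> carrier_mat n r"
  shows "greatest_divisor A dvd det (A * V)"
proof -
  let ?F = "{f. (\<forall>i\<in>{0..<r}. f i \<in> {..<n}) \<and> (\<forall>i. i \<notin> {0..<r} \<longrightarrow> f i = i)}"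
  let ?a = "\<lambda>i j. V $$ (j, i) \<cdot>\<^sub>v col A j"
  have a: "?a i \<in> {..<n} \<rightarrow> carrier_vec r" for i using A by auto
  \<comment> \<open>Transposing turns the columns to be expanded into rows, the form that
    \<open>det_linear_rows_sum\<close> handles.\<close>
  have "transpose_mat (A * V) = mat\<^sub>r r r (\<lambda>i. finsum_vec TYPE(int) r (?a i) {..<n})"
  proof (rule eq_matI; simp add: A[THEN carrier_matD(1)] V[THEN carrier_matD(2)])
    fix i j assume ij: "i < r" "j < r"
    have "finsum_vec TYPE(int) r (?a i) {..<n} $ j = (\<Sum>l<n. ?a i l $ j)"
      by (rule index_finsum_vec) (use ij a in auto)
    also have "\<dots> = row A j \<bullet> col V i"
      using A V ij by (auto simp: scalar_prod_def atLeast0LessThan mult.commute intro!: sum.cong)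
    finally show "row A j \<bullet> col V i = finsum_vec TYPE(int) r (?a i) {..<n} $ j" by simp
  qed
  then have "det (A * V) = det (mat\<^sub>r r r (\<lambda>i. finsum_vec TYPE(int) r (?a i) {..<n}))"
    using det_transpose[of "A * V" r] A V by simp
  also have "\<dots> = (\<Sum>f\<in>?F. det (mat\<^sub>r r r (\<lambda>i. ?a i (f i))))"
    by (rule det_linear_rows_sum) (use A in auto)
  also have "greatest_divisor A dvd \<dots>"
  proof (rule dvd_sum)
    fix f assume "f \<in> ?F"
    then have "greatest_divisor A dvd det (mat\<^sub>r r r (\<lambda>i. col A (f i)))"
      by (intro greatest_divisor_dvd_det_cols[OF A]) auto
    moreover have "det (mat\<^sub>r r r (\<lambda>i. ?a i (f i)))
        = (\<Prod>i\<in>{0..<r}. V $$ (f i, i)) * det (mat\<^sub>r r r (\<lambda>i. col A (f i)))"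
      by (rule det_rows_mul) (use A in auto)
    ultimately show "greatest_divisor A dvd det (mat\<^sub>r r r (\<lambda>i. ?a i (f i)))" by simp
  qed
  finally show ?thesis .
qed

text \<open>Each side divides the other: \<open>N * W * V = N\<close> writes \<open>N\<close> as a
  product starting with \<open>N * W\<close>, while every maximal minor of \<open>N * W\<close> is
  \<open>det N\<close> times the matching minor of \<open>W\<close>.\<close>

lemma greatest_divisor_mult_right_invertible:
  fixes N :: "int mat"
  assumes N: "N \<in> carrier_mat r r" and W: "W \<in> carrier_mat r n" and V: "V \<in> carrier_mat n r"
    and WV: "W * V = 1\<^sub>m r"
  shows "greatest_divisor (N * W) = \<bar>det N\<bar>"
proof -
  have NW: "N * W \<in> carrier_mat r n" using N W by simp
  have "N * W * V = N" using N W V WV by simp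
  then have "greatest_divisor (N * W) dvd det N"
    using greatest_divisor_dvd_det_mult[OF NW V] by simp
  moreover have "det N dvd greatest_divisor (N * W)"
    unfolding greatest_divisor_def
  proof (rule Gcd_greatest, clarify)
    fix J assume J: "J \<subseteq> {..<dim_col (N * W)}" "card J = dim_row (N * W)"
    have card: "card J = r" and sub: "J \<subseteq> {..<n}" using J N W by auto
    have pick: "pick J j < n" if "j < r" for j
      using pick_in_set_le[of j J] that card sub by auto
    have "submatrix (N * W) UNIV J = N * submatrix W UNIV J"
      unfolding submatrix_UNIV_cols[OF NW sub] submatrix_UNIV_cols[OF W sub]
      by (rule eq_matI) (use N W card pick in \<open>auto simp: scalar_prod_def\<close>)
    moreover have "det (N * submatrix W UNIV J) = det N * det (submatrix W UNIV J)"
      by (rule det_mult[OF N]) (simp add: submatrix_UNIV_cols[OF W sub] card)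
    ultimately show "det N dvd det (submatrix (N * W) UNIV J)" by simp
  qed
  moreover have "greatest_divisor (N * W) \<ge> 0" by (simp add: greatest_divisor_def)
  ultimately show ?thesis
    by (metis abs_of_nonneg zdvd_antisym_abs)
qed

text \<open>The product of \<open>U\<close> with its adjugate is \<open>det U\<close> times the
  identity, and \<open>det U\<close> is its own inverse, so the adjugate scaled by
  \<open>det U\<close> is an integral inverse.\<close>

lemma unimodular_inverse:
  assumes U: "U \<in> carrier_mat n n" and "unimodular U"
  obtains W where "W \<in> carrier_mat n n" "U * W = 1\<^sub>m n" "W * U = 1\<^sub>m n"
proof
  let ?W = "det U \<cdot>\<^sub>m adj_mat U"
  have sq: "det U * det U = 1" using assms by (auto simp: unimodular_def)
  note adj = adj_mat[OF U]
  show "?W \<in> carrier_mat n n" using adj by simp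
  show "U * ?W = 1\<^sub>m n"
    using adj U sq by (simp add: mult_smult_distrib[OF U adj(1)]) (rule eq_matI; simp)
  show "?W * U = 1\<^sub>m n"
    using adj U sq by (simp add: mult_smult_assoc_mat[OF adj(1) U]) (rule eq_matI; simp)
qed

text \<open>Invertibility excludes \<open>None\<close>, and inverses are unique. This identifies the
  rational inverse in the final statement with the image of an integral one.\<close>

lemma mat_inverse_eq_SomeI:
  fixes A :: "'a :: field mat"
  assumes A: "A \<in> carrier_mat n n" and B: "B \<in> carrier_mat n n"
    and AB: "A * B = 1\<^sub>m n" and BA: "B * A = 1\<^sub>m n"
  shows "mat_inverse A = Some B"
proof (cases "mat_inverse A")
  case None
  have "A \<in> Units (ring_mat TYPE('a) n ())"
    using assms by (auto simp: Units_def ring_mat_def)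
  with mat_inverse(1)[OF A None, of "()"] show ?thesis by blast
next
  case (Some C)
  from mat_inverse(2)[OF A this] have C: "C * A = 1\<^sub>m n" "C \<in> carrier_mat n n" by auto
  have "C = C * (A * B)" using C AB by simp
  also have "\<dots> = B" using assoc_mult_mat[OF C(2) A B] C B by simp
  finally show ?thesis using Some by simp
qed

lemma append_rows_mult:
  fixes A :: "'a :: semiring_0 mat"
  assumes "A \<in> carrier_mat p m" "B \<in> carrier_mat q m" "C \<in> carrier_mat m l"
  shows "(A @\<^sub>r B) * C = (A * C) @\<^sub>r (B * C)"
  by (rule eq_matI) (use assms in \<open>auto simp: append_rows_def scalar_prod_def\<close>)

lemma append_rows_mult_left:
  fixes A :: "'a :: semiring_1 mat"
  assumes P: "P \<in> carrier_mat p p" and A: "A \<in> carrier_mat p m" and B: "B \<in> carrier_mat q m"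
  shows "four_block_mat P (0\<^sub>m p q) (0\<^sub>m q p) (1\<^sub>m q) * (A @\<^sub>r B) = (P * A) @\<^sub>r B"
  unfolding append_rows_def
  \<comment> \<open>Stacked rows are a four-block matrix whose right blocks have no columns, hence
    \<open>?nc2.0 = 0\<close>.\<close>
  by (subst mult_four_block_mat[where ?nr1.0 = p and ?n1.0 = p and ?n2.0 = q and ?nr2.0 = q
        and ?nc1.0 = m and ?nc2.0 = 0])
     (use assms in auto)

lemma greatest_divisor_unimodular:
  assumes A: "A \<in> carrier_mat r n" and rn: "r \<le> n"
    and U: "U \<in> carrier_mat n n" and "unimodular U"
    and N: "N \<in> carrier_mat r r" and AU: "A * U = N @\<^sub>c 0\<^sub>m r (n - r)"
  shows "greatest_divisor A = \<bar>det N\<bar>"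
proof -
  obtain W where W: "W \<in> carrier_mat n n" and UW: "U * W = 1\<^sub>m n" and WU: "W * U = 1\<^sub>m n"
    using unimodular_inverse[OF U \<open>unimodular U\<close>] .
  let ?W = "mat r n (\<lambda>(i, j). W $$ (i, j))" and ?V = "mat n r (\<lambda>(i, j). U $$ (i, j))"
  have "A = A * (U * W)" using A UW by simp
  also have "\<dots> = A * U * W" using assoc_mult_mat[OF A U W] by simp
  also have "\<dots> = N * ?W"
  proof (rule eq_matI)
    fix i j assume "i < dim_row (N * ?W)" "j < dim_col (N * ?W)"
    then have ij: "i < r" "j < n" using N by auto
    have "(A * U * W) $$ (i, j) = (\<Sum>l<n. (A * U) $$ (i, l) * W $$ (l, j))"
      using ij W mult_carrier_mat[OF A U]
      by (subst index_mult_mat)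
         (auto simp: scalar_prod_def row_def atLeast0LessThan simp del: index_mult_mat(1))
    also have "\<dots> = (\<Sum>l<n. if l < r then N $$ (i, l) * W $$ (l, j) else 0)"
      by (rule sum.cong) (use ij N rn in \<open>auto simp: AU append_cols_def\<close>)
    also have "\<dots> = (\<Sum>l<r. N $$ (i, l) * W $$ (l, j))"
      by (rule sum.mono_neutral_cong_right) (use rn in auto)
    also have "\<dots> = (N * ?W) $$ (i, j)"
      using ij N by (simp add: scalar_prod_def atLeast0LessThan)
    finally show "(A * U * W) $$ (i, j) = (N * ?W) $$ (i, j)" .
  qed (use A W N in auto)
  finally have A_eq: "A = N * ?W" .
  \<comment> \<open>Rows of \<open>W\<close> times columns of \<open>U\<close>, both cut to the
    first \<open>r\<close>, give the upper left block of \<open>W * U\<close>, the identity.\<close>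
  have "?W * ?V = 1\<^sub>m r"
  proof (rule eq_matI)
    fix i j assume "i < dim_row (1\<^sub>m r :: int mat)" "j < dim_col (1\<^sub>m r :: int mat)"
    then have ij: "i < r" "j < r" by auto
    then have "(?W * ?V) $$ (i, j) = (W * U) $$ (i, j)"
      using W U rn by (simp add: scalar_prod_def)
    then show "(?W * ?V) $$ (i, j) = 1\<^sub>m r $$ (i, j)" using ij rn by (simp add: WU)
  qed auto
  then show ?thesis
    unfolding A_eq by (intro greatest_divisor_mult_right_invertible[OF N]) auto
qed

lemma det_lower_triangular_prod:
  assumes "M \<in> carrier_mat n n" "lower_triangular M"
  shows "det M = (\<Prod>i\<in>{0..<n}. M $$ (i, i))"
  using assms det_lower_triangular[of n M]
  by (auto simp: lower_triangular_def prod_list_diag_prod)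

theorem theorem5p2p2:
  fixes r n :: nat and d k :: int and A U U' N N' B :: "int mat"
  assumes "d > 0"
    and "r \<le> n"
    and "A \<in> carrier_mat r n"
    and "full_rank A"
    and "greatest_divisor A dvd d"
    and "k = d div greatest_divisor A"
    and "U \<in> carrier_mat n n" and "unimodular U"
    and "N \<in> carrier_mat r r" and "RHNF N"
    and "A * U = N @\<^sub>c 0\<^sub>m r (n - r)"
    and "U' \<in> carrier_mat r r" and "unimodular U'"
    and "N' \<in> carrier_mat r r" and "LHNF N'"
    and "U' * A * U = N' @\<^sub>c 0\<^sub>m r (n - r)"
    and "B \<in> carrier_mat (n - r) n"
    and "LHNF ((U' * A * U) @\<^sub>r B)"
    and "(\<Prod>i\<in>{r..<n}. ((U' * A * U) @\<^sub>r B) $$ (i, i)) = k"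
  shows "\<exists>V X. mat_inverse (map_mat rat_of_int U) = Some V \<and>
           X \<in> carrier_mat (n - r) n \<and>
           map_mat rat_of_int X = map_mat rat_of_int B * V \<and>
           (det (A @\<^sub>r X) = d \<or> det (A @\<^sub>r X) = - d)"
proof -
  let ?Q = "map_mat rat_of_int" and ?M = "(U' * A * U) @\<^sub>r B"
  note rn = assms(2) and A = assms(3) and U = assms(7) and N = assms(9) and U' = assms(12)
    and N' = assms(14) and B = assms(17)
  have U'A: "U' * A \<in> carrier_mat r n" using U' A by simp
  obtain W where W: "W \<in> carrier_mat n n" and UW: "U * W = 1\<^sub>m n" and WU: "W * U = 1\<^sub>m n"
    using unimodular_inverse[OF U assms(8)] .
  \<comment> \<open>Using the integral inverse \<open>W\<close> makes \<open>X\<close> integral at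
    once; only its agreement with the rational product remains to be shown.\<close>
  define X where "X = B * W"
  have X: "X \<in> carrier_mat (n - r) n" using B W by (simp add: X_def)
  have XU: "X * U = B"
    using assoc_mult_mat[OF B W U] WU B by (simp add: X_def)
  have inv: "mat_inverse (?Q U) = Some (?Q W)"
  proof (rule mat_inverse_eq_SomeI)
    show "?Q U * ?Q W = 1\<^sub>m n"
      using of_int_hom.mat_hom_mult[OF U W, where ?'a = rat] UW by (simp add: of_int_hom.mat_hom_one)
    show "?Q W * ?Q U = 1\<^sub>m n"
      using of_int_hom.mat_hom_mult[OF W U, where ?'a = rat] WU by (simp add: of_int_hom.mat_hom_one)
  qed (use U W in auto)
  have X_hom: "?Q X = ?Q B * ?Q W"
    unfolding X_def by (rule of_int_hom.mat_hom_mult[OF B W])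

  have AX: "A @\<^sub>r X \<in> carrier_mat n n"
    using carrier_append_rows[OF A X] rn by simp
  have M: "?M \<in> carrier_mat n n"
    using carrier_append_rows[OF _ B, of "U' * A * U" r] U'A U rn by simp
  let ?P = "four_block_mat U' (0\<^sub>m r (n - r)) (0\<^sub>m (n - r) r) (1\<^sub>m (n - r))"
  have P: "?P \<in> carrier_mat n n"
    using four_block_carrier_mat[OF U' one_carrier_mat[of "n - r"]] rn by simp
  \<comment> \<open>\<open>?P\<close> applies \<open>U'\<close> to the rows of \<open>A\<close> and
    fixes those of \<open>X\<close>; then \<open>U\<close> turns \<open>X\<close> into
    \<open>B\<close>.\<close>
  have "?M = ?P * (A @\<^sub>r X) * U"
    using append_rows_mult_left[OF U' A X] append_rows_mult[OF U'A X U] XU by simp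
  then have "det ?M = det ?P * det (A @\<^sub>r X) * det U"
    using det_mult[OF mult_carrier_mat[OF P AX] U] det_mult[OF P AX] by simp
  moreover have "det ?P = det U'"
    using det_four_block_mat_upper_right_zero[OF U' refl, of "0\<^sub>m (n - r) r" "n - r" "1\<^sub>m (n - r)"] by simp
  ultimately have abs_M: "\<bar>det ?M\<bar> = \<bar>det (A @\<^sub>r X)\<bar>"
    using assms(8) assms(13) by (auto simp: unimodular_def abs_mult)

  have "det ?M = (\<Prod>i\<in>{0..<n}. ?M $$ (i, i))"
    using assms(18) M by (intro det_lower_triangular_prod) (auto simp: LHNF_def)
  also have "\<dots> = (\<Prod>i\<in>{0..<r}. ?M $$ (i, i)) * (\<Prod>i\<in>{r..<n}. ?M $$ (i, i))"
    using rn by (simp add: prod.atLeastLessThan_concat)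
  also have "(\<Prod>i\<in>{0..<r}. ?M $$ (i, i)) = (\<Prod>i\<in>{0..<r}. N' $$ (i, i))"
    by (rule prod.cong) (use rn N' B in \<open>auto simp: assms(16) append_rows_def append_cols_def\<close>)
  also have "\<dots> = det N'"
    using assms(15) N' det_lower_triangular_prod[of N' r] by (auto simp: LHNF_def)
  finally have det_M: "det ?M = det N' * k" using assms(19) by simp

  \<comment> \<open>Both are the first \<open>r\<close> columns of
    \<open>U' * A * U\<close>.\<close>
  have "N' = U' * N"
  proof (rule eq_matI)
    fix i j assume "i < dim_row (U' * N)" "j < dim_col (U' * N)"
    then have ij: "i < r" "j < r" using U' N by auto
    have "N' $$ (i, j) = (U' * A * U) $$ (i, j)"
      using ij N' rn by (simp add: assms(16) append_cols_def)
    also have "U' * A * U = U' * (A * U)" by (rule assoc_mult_mat[OF U' A U])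
    also have "\<dots> $$ (i, j) = (U' * N) $$ (i, j)"
      using ij U' N rn by (simp add: assms(11) append_cols_def scalar_prod_def)
    finally show "N' $$ (i, j) = (U' * N) $$ (i, j)" .
  qed (use U' N N' in auto)
  then have "\<bar>det N'\<bar> = \<bar>det N\<bar>"
    using det_mult[OF U' N] assms(13) by (auto simp: unimodular_def abs_mult)
  also have "\<dots> = greatest_divisor A"
    using greatest_divisor_unimodular[OF A rn U assms(8) N assms(11)] by simp
  finally have "\<bar>det N'\<bar> = greatest_divisor A" .
  then have "\<bar>det (A @\<^sub>r X)\<bar> = \<bar>greatest_divisor A * k\<bar>"
    using abs_M det_M by (simp add: abs_mult)
  \<comment> \<open>The division defining \<open>k\<close> is exact, and \<open>d\<close> is
    positive.\<close>
  also have "\<dots> = d" using assms(1,5,6) by simp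
  finally have "det (A @\<^sub>r X) = d \<or> det (A @\<^sub>r X) = - d" by linarith
  with inv X X_hom show ?thesis by blast
qed

end
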